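(* For every fixed $\alpha>0$ and every $\epsilon>0$ there exists $N=N(\alpha,\epsilon)$ such that for all $n>N$: if $G$ is a graph on $n$ vertices with diameter $2$ that has at most $n^{2-\alpha}$ edges or at least $\binom{n}{2}-n^{2-\alpha}$ edges, then $h(G)\ge n/2-\epsilon n$.
   Context: For a graph $G$ and $S\subseteq V(G)$, the distance multiset $D(S)$ is the multiset of shortest-path distances in $G$ between all unordered pairs of distinct vertices of $S$. Two vertex sets $S_1,S_2$ are homometric if $D(S_1)=D(S_2)$. $h(G)$ is the largest integer $h$ such that $G$ contains two disjoint homometric sets $S_1,S_2$ with $|S_1|=|S_2|=h$. *)

theory Defs
  imports
    Complex_Main
    "HOL-Library.Multiset"
    "Graph_Theory.Graph_Theory"
begin

text \<open>A finite simple graph is a \<^locale>\<open>pair_graph\<close>: a finite, loop-free, symmetric set of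
  ordered pairs. Each edge is thus represented by two opposite arcs.\<close>

definition edges :: "'a pair_pre_digraph \<Rightarrow> 'a set set" where
  "edges G = (\<lambda>(u, v). {u, v}) ` parcs G"

text \<open>With unit weights, the library's shortest-path cost is the usual distance
  (\<open>\<infinity>\<close> between different components).\<close>

definition gdist :: "'a pair_pre_digraph \<Rightarrow> 'a \<Rightarrow> 'a \<Rightarrow> ereal" where
  "gdist G u v = wf_digraph.\<mu> (with_proj G) (\<lambda>_. 1) u v"

definition diameter :: "'a pair_pre_digraph \<Rightarrow> ereal" where
  "diameter G = (SUP u\<in>pverts G. SUP v\<in>pverts G. gdist G u v)"

lemma gdist_le_commute:
  assumes "pair_graph G"
  shows "gdist G u v \<le> gdist G v u"
proof -
  interpret pair_graph G by fact
  show ?thesis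
    unfolding gdist_def \<mu>_def
  proof (rule INF_mono)
    fix p assume "p \<in> {p. awalk v p u}"
    then have "awalk u (rev_path p) v" by (simp add: awalk_rev_path)
    moreover have "awalk_cost (\<lambda>_. 1) (rev_path p) = awalk_cost (\<lambda>_. 1) p"
      by (induction p) (auto simp: awalk_cost_def)
    ultimately show "\<exists>q\<in>{q. awalk u q v}.
        ereal (awalk_cost (\<lambda>_. 1) q) \<le> ereal (awalk_cost (\<lambda>_. 1) p)"
      by (intro bexI[of _ "rev_path p"]) auto
  qed
qed

lemma gdist_commute: "pair_graph G \<Longrightarrow> gdist G u v = gdist G v u"
  by (simp add: antisym gdist_le_commute)

text \<open>The distance of an unordered pair is well defined because \<^const>\<open>gdist\<close> is symmetric
  on graphs.\<close>

definition pair_dist :: "'a pair_pre_digraph \<Rightarrow> 'a set \<Rightarrow> ereal" where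
  "pair_dist G e = (THE d. \<exists>u v. e = {u, v} \<and> d = gdist G u v)"

lemma pair_dist_insert: "pair_graph G \<Longrightarrow> pair_dist G {u, v} = gdist G u v"
  unfolding pair_dist_def by (rule the_equality) (auto simp: doubleton_eq_iff gdist_commute)

definition distance_mset :: "'a pair_pre_digraph \<Rightarrow> 'a set \<Rightarrow> ereal multiset" where
  "distance_mset G S = image_mset (pair_dist G) (mset_set {e. e \<subseteq> S \<and> card e = 2})"

definition homometric :: "'a pair_pre_digraph \<Rightarrow> 'a set \<Rightarrow> 'a set \<Rightarrow> bool" where
  "homometric G S T \<longleftrightarrow> distance_mset G S = distance_mset G T"

definition homometric_sizes :: "'a pair_pre_digraph \<Rightarrow> nat set" where
  "homometric_sizes G =
     {k. \<exists>S T. S \<subseteq> pverts G \<and> T \<subseteq> pverts G \<and> S \<inter> T = {} \<and>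
          card S = k \<and> card T = k \<and> homometric G S T}"

definition homometric_number :: "'a pair_pre_digraph \<Rightarrow> nat" where
  "homometric_number G = Max (homometric_sizes G)"

lemma
  assumes "pair_graph G"
  shows finite_homometric_sizes: "finite (homometric_sizes G)"
    and homometric_sizes_nonempty: "homometric_sizes G \<noteq> {}"
proof -
  interpret pair_graph G by fact
  have "homometric_sizes G \<subseteq> {..card (pverts G)}"
    using pair_finite_verts by (auto simp: homometric_sizes_def intro: card_mono)
  then show "finite (homometric_sizes G)" by (rule finite_subset) simp
  have "0 \<in> homometric_sizes G"
    unfolding homometric_sizes_def homometric_def
    by (intro CollectI exI[of _ "{}"]) auto
  then show "homometric_sizes G \<noteq> {}" by auto
qed

end

theory Submission
  imports Defs "HOL-Library.Disjoint_Sets" "HOL-Real_Asymp.Real_Asymp"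
begin

text \<open>In a graph of diameter 2 the distance multiset of a set is determined by its size and the
  number of its edges, so it suffices to find two disjoint sets of equal size spanning equally many
  edges, either in the graph or in its complement, whichever is sparse. If \<open>A\<close> and \<open>B\<close> partition
  \<open>W\<close>, the arcs between them cancel: \<open>A\<close> and \<open>B\<close> span equally many edges iff their degree sums
  in \<open>W\<close> agree. Delete the few vertices of degree above \<open>D = n powr (1 - \<beta>)\<close> and take a maximal
  family of disjoint pairs of vertices with equal degree but different neighbourhoods.

  If the family is small, delete it; any two remaining vertices of equal degree are then twins,
  and splitting twin pairs between \<open>A\<close> and \<open>B\<close> balances the degree sums. If it is large, then
  among pairs whose neighbourhoods differ in about the same number of vertices, a greedily chosen
  set of at most \<open>2 * D + 1\<close> vertices meets these differences exactly once for at least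
  \<open>2 * D + 1\<close> pairs. After deleting it, the degrees within each of those pairs differ by one. Any
  greedy halving of the other vertices has degree imbalance at most \<open>D\<close>, which the pairs
  reduce to at most 1, and parity makes it 0.\<close>

section \<open>Families of disjoint pairs\<close>

definition ends :: "'a \<times> 'a \<Rightarrow> 'a set" where
  "ends p = {fst p, snd p}"

text \<open>A matching, unrelated to adjacency. Its pairs are oriented so that \<open>fst\<close>
  and \<open>snd\<close> select one end of each.\<close>

definition pairing :: "('a \<times> 'a) set \<Rightarrow> bool" where
  "pairing I \<longleftrightarrow> (\<forall>p\<in>I. fst p \<noteq> snd p) \<and> disjoint_family_on ends I"

lemma finite_ends [simp]: "finite (ends p)"
  by (simp add: ends_def)

lemma pairing_subset: "pairing I \<Longrightarrow> J \<subseteq> I \<Longrightarrow> pairing J"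
  unfolding pairing_def disjoint_family_on_def by blast

lemma card_ends: "fst p \<noteq> snd p \<Longrightarrow> card (ends p) = 2"
  by (simp add: ends_def)

lemma card_Union_ends:
  assumes "pairing I" "finite I"
  shows "card (\<Union>p\<in>I. ends p) = 2 * card I"
proof -
  have "card (\<Union>p\<in>I. ends p) = (\<Sum>p\<in>I. card (ends p))"
    using assms by (intro card_UN_disjoint') (auto simp: pairing_def)
  also have "\<dots> = (\<Sum>p\<in>I. 2)"
    using assms by (intro sum.cong refl card_ends) (auto simp: pairing_def)
  finally show ?thesis by simp
qed

text \<open>Choosing a point of \<open>S\<close> in every member that meets \<open>S\<close> is
  injective, because the members are disjoint.\<close>

lemma card_disjoint_meeting_le:
  assumes "disjoint_family_on E I" "finite S"
  shows "card {i\<in>I. E i \<inter> S \<noteq> {}} \<le> card S"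
proof (rule card_inj_on_le)
  show "inj_on (\<lambda>i. SOME x. x \<in> E i \<inter> S) {i\<in>I. E i \<inter> S \<noteq> {}}"
  proof (rule inj_onI)
    fix i j
    assume i: "i \<in> {i\<in>I. E i \<inter> S \<noteq> {}}" and j: "j \<in> {i\<in>I. E i \<inter> S \<noteq> {}}"
      and eq: "(SOME x. x \<in> E i \<inter> S) = (SOME x. x \<in> E j \<inter> S)"
    have "(SOME x. x \<in> E i \<inter> S) \<in> E i" "(SOME x. x \<in> E j \<inter> S) \<in> E j"
      using i j some_in_eq[of "E i \<inter> S"] some_in_eq[of "E j \<inter> S"] by auto
    with eq i j assms(1) show "i = j"
      by (force simp: disjoint_family_on_def)
  qed
  show "(\<lambda>i. SOME x. x \<in> E i \<inter> S) ` {i\<in>I. E i \<inter> S \<noteq> {}} \<subseteq> S"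
    using some_in_eq[where A = "E i \<inter> S" for i] by auto
qed (use assms in auto)

text \<open>A family of largest cardinality works: two uncovered vertices related by
  \<open>Q\<close> could be added as a further pair.\<close>

lemma exists_maximal_pairing:
  assumes "finite X"
  obtains I where "I \<subseteq> X \<times> X" "pairing I" "\<And>p. p \<in> I \<Longrightarrow> Q (fst p) (snd p)"
    "\<And>v w. v \<in> X - (\<Union>p\<in>I. ends p) \<Longrightarrow> w \<in> X - (\<Union>p\<in>I. ends p) \<Longrightarrow> v \<noteq> w \<Longrightarrow> \<not> Q v w"
proof -
  define F where "F = {I. I \<subseteq> X \<times> X \<and> pairing I \<and> (\<forall>p\<in>I. Q (fst p) (snd p))}"
  have "finite F"
    unfolding F_def using assms by (rule_tac finite_subset[of _ "Pow (X \<times> X)"]) auto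
  moreover have "{} \<in> F"
    by (auto simp: F_def pairing_def disjoint_family_on_def)
  ultimately obtain I where I: "I \<in> F" and max: "\<And>J. J \<in> F \<Longrightarrow> card J \<le> card I"
    using Max_in[of "card ` F"] Max_ge[of "card ` F"] by fastforce
  have "\<not> Q v w"
    if vw: "v \<in> X - (\<Union>p\<in>I. ends p)" "w \<in> X - (\<Union>p\<in>I. ends p)" "v \<noteq> w" for v w
  proof
    assume "Q v w"
    have "pairing (insert (v, w) I)"
      using I vw by (auto simp: F_def pairing_def disjoint_family_on_def ends_def)
    with \<open>Q v w\<close> I vw have "insert (v, w) I \<in> F"
      by (auto simp: F_def)
    moreover have "(v, w) \<notin> I"
      using vw by (auto simp: ends_def)
    moreover have "finite I"
      using I finite_subset[of I "X \<times> X"] assms unfolding F_def by blast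
    ultimately show False
      using max[of "insert (v, w) I"] by simp
  qed
  with I that[of I] show thesis
    unfolding F_def by blast
qed

section \<open>Hitting many sets exactly once\<close>

text \<open>Double counting of the incidences \<open>(u, i)\<close> with
  \<open>u \<in> S i\<close>.\<close>

lemma sum_card_incidence:
  assumes "finite V" "finite Z" "\<And>i. i \<in> Z \<Longrightarrow> S i \<subseteq> V"
  shows "(\<Sum>u\<in>V. card {i\<in>Z. u \<in> S i}) = (\<Sum>i\<in>Z. card (S i))"
proof -
  have "(\<Sum>u\<in>V. card {i\<in>Z. u \<in> S i}) = (\<Sum>u\<in>V. \<Sum>i\<in>Z. if u \<in> S i then 1 else 0)"
    using assms by (simp add: sum.If_cases Int_def)
  also have "\<dots> = (\<Sum>i\<in>Z. \<Sum>u\<in>V. if u \<in> S i then 1 else 0)"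
    by (rule sum.swap)
  also have "\<dots> = (\<Sum>i\<in>Z. card (S i))"
    using assms by (intro sum.cong refl) (simp add: sum.If_cases Int_absorb1)
  finally show ?thesis .
qed

text \<open>Greedy choice: while most sets are not hit, double counting yields a vertex hitting for the
  first time more than twice as many sets as it spoils among those hit once. The factor 2 keeps the
  number of unhit sets large, as the invariant \<open>card I \<le> card (Z 0 R) + 3 * card (Z 1 R)\<close> records.\<close>

lemma exists_hitting_once:
  fixes K E :: "'i \<Rightarrow> 'a set"
  assumes fin: "finite V" "finite I" and "\<kappa> \<ge> 1"
    and K: "\<And>i. i \<in> I \<Longrightarrow> K i \<subseteq> V" "\<And>i. i \<in> I \<Longrightarrow> \<kappa> \<le> card (K i)"
      "\<And>i. i \<in> I \<Longrightarrow> card (K i) \<le> 2 * \<kappa>"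
    and E: "\<And>i. i \<in> I \<Longrightarrow> E i \<subseteq> V" "\<And>i. i \<in> I \<Longrightarrow> card (E i) \<le> 2"
      "disjoint_family_on E I"
    and KE: "\<And>i. i \<in> I \<Longrightarrow> K i \<inter> E i = {}"
    and g: "11 * g \<le> card I"
  shows "\<exists>R\<subseteq>V. card R \<le> g \<and> g \<le> card {i\<in>I. E i \<inter> R = {} \<and> card (K i \<inter> R) = 1}"
proof -
  define Z where "Z j R = {i\<in>I. E i \<inter> R = {} \<and> card (K i \<inter> R) = j}" for j :: nat and R
  have finZ: "finite (Z j R)" for j R
    using fin by (simp add: Z_def)
  have finK: "finite (K i)" if "i \<in> I" for i
    using K(1)[OF that] fin finite_subset by blast
  have "\<exists>R\<subseteq>V. card R \<le> r \<and> card I \<le> card (Z 0 R) + 3 * card (Z 1 R) \<and> r \<le> card (Z 1 R)"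
    if "r \<le> g" for r
    using that
  proof (induction r)
    case 0
    have "Z 0 {} = I" by (simp add: Z_def)
    then show ?case by (intro exI[of _ "{}"]) simp
  next
    case (Suc r)
    then obtain R where R: "R \<subseteq> V" "card R \<le> r"
      "card I \<le> card (Z 0 R) + 3 * card (Z 1 R)" "r \<le> card (Z 1 R)"
      by auto
    show ?case
    proof (cases "Suc r \<le> card (Z 1 R)")
      case True
      with R show ?thesis by (intro exI[of _ R]) auto
    next
      case False
      define new where "new u = {i \<in> Z 0 R. u \<in> K i}" for u
      define lost where "lost u = {i \<in> Z 1 R. u \<in> K i \<union> E i}" for u
      define dead where "dead u = {i \<in> I. E i \<inter> {u} \<noteq> {}}" for u
      \<comment> \<open>Here \<open>card (Z 1 R) = r < g\<close>. The constant 11 is 3 + 8: the 3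
        comes from the invariant, the 8 is what the averaging below needs.\<close>
      have many: "8 * card (Z 1 R) < card (Z 0 R)"
        using R False g Suc.prems by linarith
      \<comment> \<open>By averaging over \<open>u\<close>: an index in \<open>Z 0 R\<close> is
        newly hit by at least \<open>\<kappa>\<close> vertices, while one in \<open>Z 1 R\<close> is
        lost to at most \<open>2 * \<kappa> + 2 \<le> 4 * \<kappa>\<close> vertices.\<close>
      have "\<exists>u\<in>V. 2 * card (lost u) < card (new u)"
      proof (rule ccontr)
        assume "\<not> ?thesis"
        then have "(\<Sum>u\<in>V. card (new u)) \<le> (\<Sum>u\<in>V. 2 * card (lost u))"
          by (intro sum_mono) (auto simp: not_less)
        also have "\<dots> = 2 * (\<Sum>u\<in>V. card (lost u))"
          by (simp add: sum_distrib_left)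
        also have "(\<Sum>u\<in>V. card (lost u)) = (\<Sum>i\<in>Z 1 R. card (K i \<union> E i))"
          unfolding lost_def using K(1) E(1) fin finZ
          by (intro sum_card_incidence) (auto simp: Z_def)
        also have "\<dots> \<le> (\<Sum>i\<in>Z 1 R. 4 * \<kappa>)"
        proof (rule sum_mono)
          fix i assume "i \<in> Z 1 R"
          then have "i \<in> I" by (simp add: Z_def)
          then show "card (K i \<union> E i) \<le> 4 * \<kappa>"
            using card_Un_le[of "K i" "E i"] K(3)[of i] E(2)[of i] \<open>\<kappa> \<ge> 1\<close> by linarith
        qed
        finally have le: "(\<Sum>u\<in>V. card (new u)) \<le> 2 * (\<Sum>i\<in>Z 1 R. 4 * \<kappa>)"
          by simp
        have "(\<Sum>i\<in>Z 0 R. \<kappa>) \<le> (\<Sum>i\<in>Z 0 R. card (K i))"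
          using K(2) by (intro sum_mono) (auto simp: Z_def)
        also have "\<dots> = (\<Sum>u\<in>V. card (new u))"
          unfolding new_def using K(1) fin finZ
          by (intro sum_card_incidence[symmetric]) (auto simp: Z_def)
        also note le
        finally have "card (Z 0 R) * \<kappa> \<le> (8 * card (Z 1 R)) * \<kappa>"
          by simp
        with many \<open>\<kappa> \<ge> 1\<close> show False by simp
      qed
      then obtain u where u: "u \<in> V" "2 * card (lost u) < card (new u)" by auto
      have disj: "K i \<inter> R = {}" if "i \<in> Z 0 R" for i
        using that finK by (auto simp: Z_def)
      have "u \<notin> R"
      proof
        assume "u \<in> R"
        then have "new u = {}" using disj by (auto simp: new_def)
        with u show False by simp
      qed
      have ins: "K i \<inter> insert u R = (if u \<in> K i then insert u (K i \<inter> R) else K i \<inter> R)" for i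
        by auto
      \<comment> \<open>A newly hit index is not spoiled through its own ends, since
        \<open>K i\<close> and \<open>E i\<close> are disjoint.\<close>
      have sub1: "(Z 1 R - lost u) \<union> new u \<subseteq> Z 1 (insert u R)"
        using KE disj[unfolded Z_def] \<open>u \<notin> R\<close> by (force simp: Z_def lost_def new_def ins)
      have "card (Z 1 R) - card (lost u) + card (new u) = card ((Z 1 R - lost u) \<union> new u)"
      proof -
        have "lost u \<subseteq> Z 1 R" "(Z 1 R - lost u) \<inter> new u = {}" "finite (new u)"
          using fin(2) by (auto simp: lost_def new_def Z_def)
        then show ?thesis
          using finZ[of 1 R] by (simp add: card_Un_disjoint card_Diff_subset finite_subset)
      qed
      also have "\<dots> \<le> card (Z 1 (insert u R))"
        using sub1 finZ by (rule card_mono[rotated])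
      finally have 1: "card (Z 1 R) + card (new u) \<le> card (Z 1 (insert u R)) + card (lost u)"
        by linarith
      \<comment> \<open>An index leaves \<open>Z 0\<close> only by being hit or because
        \<open>u\<close> lies in \<open>E i\<close>. As the sets \<open>E i\<close> are disjoint,
        the second happens to at most one index.\<close>
      have "Z 0 R \<subseteq> Z 0 (insert u R) \<union> new u \<union> dead u"
        by (auto simp: Z_def new_def dead_def)
      then have "card (Z 0 R) \<le> card (Z 0 (insert u R) \<union> new u \<union> dead u)"
        using finZ fin by (intro card_mono) (auto simp: new_def dead_def)
      also have "\<dots> \<le> card (Z 0 (insert u R)) + card (new u) + card (dead u)"
        by (meson add_mono card_Un_le le_refl order_trans)
      also have "card (dead u) \<le> 1"
        unfolding dead_def using card_disjoint_meeting_le[OF E(3), of "{u}"] by simp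
      finally have 2: "card (Z 0 R) \<le> card (Z 0 (insert u R)) + card (new u) + 1"
        by simp
      have "card (insert u R) \<le> Suc r"
        using R(2) card_insert_le_m1 by (metis Suc_le_mono card_insert_le_m1 card_insert_if
            finite_subset[OF R(1) fin(1)] le_SucI)
      \<comment> \<open>From \<open>2 * card (lost u) < card (new u)\<close>, three times the growth
        of \<open>Z 1\<close> is at least \<open>card (new u) + 1\<close>, the most that
        \<open>Z 0\<close> can lose, so the invariant survives.\<close>
      then show ?thesis
        using R u 1 2 by (intro exI[of _ "insert u R"]) auto
    qed
  qed
  from this[of g] show ?thesis
    by (auto simp: Z_def)
qed

section \<open>Balanced partitions\<close>

text \<open>Add the vertices two at a time, the one with the larger value to the part with the
  smaller sum. The imbalance is pushed towards zero by at most \<open>D\<close>, so it may change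
  sign but stays within \<open>D\<close>.\<close>

lemma balanced_partition:
  fixes f :: "'a \<Rightarrow> nat"
  assumes "finite W" "even (card W)" "\<And>v. v \<in> W \<Longrightarrow> f v \<le> D"
  shows "\<exists>A B. A \<union> B = W \<and> A \<inter> B = {} \<and> card A = card B \<and>
    \<bar>int (sum f A) - int (sum f B)\<bar> \<le> int D"
  using assms
proof (induction "card W" arbitrary: W rule: less_induct)
  case less
  show ?case
  proof (cases "W = {}")
    case True
    then show ?thesis by (intro exI[of _ "{}"]) simp
  next
    case False
    then obtain v where v: "v \<in> W" by auto
    have "W \<noteq> {v}" using less.prems(2) by auto
    with v obtain w where w: "w \<in> W" "w \<noteq> v" by auto
    define X where "X = W - {v, w}"
    have cX: "card W = card X + 2"
      using v w less.prems(1) card_Diff_subset[of "{v, w}" W] card_mono[of W "{v, w}"]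
      by (auto simp: X_def)
    then obtain A B where AB: "A \<union> B = X" "A \<inter> B = {}" "card A = card B"
      "\<bar>int (sum f A) - int (sum f B)\<bar> \<le> int D"
      using less.hyps[of X] less.prems by (auto simp: X_def)
    have fins: "finite A" "finite B"
      using AB(1) less.prems(1) by (auto simp: X_def intro: finite_subset)
    have notin: "v \<notin> A" "v \<notin> B" "w \<notin> A" "w \<notin> B"
      using AB(1) by (auto simp: X_def)
    have W: "W = insert v (insert w X)"
      using v w by (auto simp: X_def)
    have f: "f v \<le> D" "f w \<le> D"
      using v w less.prems(3) by auto
    show ?thesis
    proof (cases "(sum f A \<le> sum f B) = (f w \<le> f v)")
      case True
      then show ?thesis
        using AB fins notin W w f
        by (intro exI[of _ "insert v A"] exI[of _ "insert w B"]) (auto simp del: of_nat_sum)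
    next
      case False
      then show ?thesis
        using AB fins notin W w f
        by (intro exI[of _ "insert w A"] exI[of _ "insert v B"]) (auto simp del: of_nat_sum)
    qed
  qed
qed

text \<open>Splitting a pair changes the imbalance by exactly one, in a direction of choice. A
  positive imbalance drops by one and a zero imbalance becomes one, whence the maximum with
  1.\<close>

lemma balanced_partition_extend:
  fixes f :: "'a \<Rightarrow> nat"
  assumes "finite I" "pairing I" "\<And>p. p \<in> I \<Longrightarrow> ends p \<inter> (A \<union> B) = {}"
    and "\<And>p. p \<in> I \<Longrightarrow> f (fst p) = Suc (f (snd p)) \<or> f (snd p) = Suc (f (fst p))"
    and "finite A" "finite B" "A \<inter> B = {}" "card A = card B"
    and "\<bar>int (sum f A) - int (sum f B)\<bar> \<le> int D"
  shows "\<exists>A' B'. A' \<union> B' = A \<union> B \<union> (\<Union>p\<in>I. ends p) \<and> A' \<inter> B' = {} \<and> card A' = card B' \<and>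
    \<bar>int (sum f A') - int (sum f B')\<bar> \<le> max 1 (int D - int (card I))"
  using assms(1-4)
proof (induction I rule: finite_induct)
  case empty
  with assms show ?case by (intro exI[of _ A] exI[of _ B]) auto
next
  case (insert p I)
  obtain A' B' where AB: "A' \<union> B' = A \<union> B \<union> (\<Union>p\<in>I. ends p)" "A' \<inter> B' = {}"
    "card A' = card B'" "\<bar>int (sum f A') - int (sum f B')\<bar> \<le> max 1 (int D - int (card I))"
  proof -
    have "pairing I"
      using insert.prems(1) by (rule pairing_subset) auto
    then have "\<exists>A' B'. A' \<union> B' = A \<union> B \<union> (\<Union>p\<in>I. ends p) \<and> A' \<inter> B' = {} \<and>
        card A' = card B' \<and> \<bar>int (sum f A') - int (sum f B')\<bar> \<le> max 1 (int D - int (card I))"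
      by (rule insert.IH) (use insert.prems(2,3) in blast)+
    with that show thesis by (elim exE conjE)
  qed
  obtain v w where p: "p = (v, w)" by (cases p)
  have fins: "finite A'" "finite B'"
    using AB(1) assms(5,6) insert.hyps(1) by (metis finite_UN finite_Un finite_ends)+
  have vw: "v \<noteq> w"
    using insert.prems(1) by (auto simp: p pairing_def)
  have "ends p \<inter> ends q = {}" if "q \<in> I" for q
    using insert.prems(1) insert.hyps(2) that
    by (auto simp: pairing_def disjoint_family_on_def)
  then have "ends p \<inter> (A' \<union> B') = {}"
    using insert.prems(2)[of p] AB(1) by auto
  then have notin: "v \<notin> A'" "v \<notin> B'" "w \<notin> A'" "w \<notin> B'"
    by (auto simp: ends_def p)
  have U: "A \<union> B \<union> (\<Union>p\<in>insert p I. ends p) = insert v (insert w (A' \<union> B'))"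
    using AB(1) by (auto simp: ends_def p)
  have f: "f v = Suc (f w) \<or> f w = Suc (f v)"
    using insert.prems(3)[of p] by (simp add: p)
  show ?case
  proof (cases "(sum f A' \<le> sum f B') = (f w \<le> f v)")
    case True
    then show ?thesis
      unfolding U using AB(2-4) fins notin vw f insert.hyps
      by (intro exI[of _ "insert v A'"] exI[of _ "insert w B'"]) (auto simp del: of_nat_sum)
  next
    case False
    then show ?thesis
      unfolding U using AB(2-4) fins notin vw f insert.hyps
      by (intro exI[of _ "insert w A'"] exI[of _ "insert v B'"]) (auto simp del: of_nat_sum)
  qed
qed


section \<open>Degrees in induced subgraphs\<close>

text \<open>Abstract so that it can be interpreted both by adjacency and by non-adjacency of
  distinct vertices; the sparse and the dense case then share one argument.\<close>

locale graph_relation =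
  fixes adj :: "'a \<Rightarrow> 'a \<Rightarrow> bool"
  assumes sym: "adj u v \<Longrightarrow> adj v u" and irrefl: "\<not> adj v v"
begin

definition deg :: "'a set \<Rightarrow> 'a \<Rightarrow> nat" where
  "deg W v = card {u\<in>W. adj v u}"

text \<open>For finite \<open>A\<close>, twice the number of edges spanned by
  \<open>A\<close>.\<close>

definition arc_count :: "'a set \<Rightarrow> nat" where
  "arc_count A = (\<Sum>v\<in>A. deg A v)"

text \<open>Leaving out \<open>v\<close> and \<open>w\<close> themselves makes emptiness mean that
  they are twins in \<open>W\<close>, whether adjacent or not.\<close>

definition separators :: "'a set \<Rightarrow> 'a \<Rightarrow> 'a \<Rightarrow> 'a set" where
  "separators W v w = {u\<in>W. u \<noteq> v \<and> u \<noteq> w \<and> adj v u \<noteq> adj w u}"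

lemma adj_commute: "adj u v \<longleftrightarrow> adj v u"
  using sym by blast

lemma deg_mono: "finite B \<Longrightarrow> A \<subseteq> B \<Longrightarrow> deg A v \<le> deg B v"
  unfolding deg_def by (intro card_mono) auto

lemma deg_Un:
  assumes "finite A" "finite B" "A \<inter> B = {}"
  shows "deg (A \<union> B) v = deg A v + deg B v"
proof -
  have "{u\<in>A \<union> B. adj v u} = {u\<in>A. adj v u} \<union> {u\<in>B. adj v u}"
    by auto
  with assms show ?thesis
    unfolding deg_def by (simp add: card_Un_disjoint disjoint_iff)
qed

lemma deg_singleton: "deg {x} v = of_bool (adj v x)"
  by (cases "adj v x") (simp_all add: deg_def conj_commute cong: conj_cong)

text \<open>Both sums count the adjacent pairs in \<open>A \<times> B\<close>.\<close>

lemma sum_deg_commute: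
  assumes "finite A" "finite B"
  shows "(\<Sum>v\<in>A. deg B v) = (\<Sum>v\<in>B. deg A v)"
proof -
  have "(\<Sum>v\<in>A. deg B v) = (\<Sum>v\<in>A. card {u\<in>B. v \<in> {w\<in>A. adj u w}})"
    unfolding deg_def by (intro sum.cong refl arg_cong[where f = card]) (auto simp: adj_commute)
  also have "\<dots> = (\<Sum>u\<in>B. card {w\<in>A. adj u w})"
    using assms by (intro sum_card_incidence) auto
  finally show ?thesis by (simp add: deg_def)
qed

lemma sum_deg_Un:
  assumes "finite A" "finite B" "A \<inter> B = {}"
  shows "(\<Sum>v\<in>A. deg (A \<union> B) v) = arc_count A + (\<Sum>v\<in>A. deg B v)"
  using assms by (simp add: deg_Un arc_count_def sum.distrib)

text \<open>The arcs between the two parts contribute equally to both degree sums.\<close>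

lemma arc_count_eqI:
  assumes "finite A" "finite B" "A \<inter> B = {}"
    and "(\<Sum>v\<in>A. deg (A \<union> B) v) = (\<Sum>v\<in>B. deg (A \<union> B) v)"
  shows "arc_count A = arc_count B"
  using assms sum_deg_Un[of A B] sum_deg_Un[of B A] sum_deg_commute[of A B]
  by (simp add: Un_commute Int_commute)

lemma arc_count_insert:
  assumes "finite A" "x \<notin> A"
  shows "arc_count (insert x A) = arc_count A + 2 * deg A x"
proof -
  have "arc_count (insert x A) = (\<Sum>v\<in>A. deg (A \<union> {x}) v) + (\<Sum>v\<in>{x}. deg ({x} \<union> A) v)"
    using assms by (simp add: arc_count_def)
  then show ?thesis
    using assms sum_deg_Un[of A "{x}"] sum_deg_Un[of "{x}" A] sum_deg_commute[of A "{x}"]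
    by (simp add: arc_count_def deg_singleton irrefl)
qed

lemma arc_count_eq_card_edges:
  "finite S \<Longrightarrow> arc_count S = 2 * card {{u, v} |u v. u \<in> S \<and> v \<in> S \<and> adj u v}"
proof (induction S rule: finite_induct)
  case empty
  then show ?case by (simp add: arc_count_def)
next
  case (insert x S)
  define P where "P S = {{u, v} |u v. u \<in> S \<and> v \<in> S \<and> adj u v}" for S
  have "P (insert x S) = P S \<union> (\<lambda>u. {x, u}) ` {u\<in>S. adj x u}"
    using irrefl sym unfolding P_def by blast
  moreover have "finite (P S)"
    by (rule finite_subset[of _ "Pow S"]) (use insert.hyps in \<open>auto simp: P_def\<close>)
  moreover have "P S \<inter> (\<lambda>u. {x, u}) ` {u\<in>S. adj x u} = {}"
    using insert.hyps by (auto simp: P_def doubleton_eq_iff)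
  ultimately have "card (P (insert x S)) = card (P S) + card ((\<lambda>u. {x, u}) ` {u\<in>S. adj x u})"
    using insert.hyps by (simp add: card_Un_disjoint)
  also have "card ((\<lambda>u. {x, u}) ` {u\<in>S. adj x u}) = deg S x"
    unfolding deg_def by (intro card_image) (auto simp: inj_on_def doubleton_eq_iff)
  finally show ?case
    using insert.IH insert.hyps unfolding P_def by (simp add: arc_count_insert)
qed

lemma even_arc_count: "finite A \<Longrightarrow> even (arc_count A)"
  by (simp add: arc_count_eq_card_edges)

text \<open>Twins have the same neighbours outside \<open>{v, w}\<close>, and inside it each gains
  one exactly if they are adjacent.\<close>

lemma deg_eq_if_no_separators:
  assumes "finite W" "v \<in> W" "w \<in> W" "v \<noteq> w" "separators W v w = {}"
  shows "deg W v = deg W w"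
proof -
  have "W = (W - {v, w}) \<union> ({v} \<union> {w})"
    using assms by auto
  then have "deg W x = deg (W - {v, w}) x + (deg {v} x + deg {w} x)" for x
    using assms by (metis deg_Un finite_Diff finite_Un finite.simps Diff_disjoint Int_commute
        Int_insert_right_if0 Int_empty_right insert_is_Un singletonD)
  moreover have "deg (W - {v, w}) v = deg (W - {v, w}) w"
    unfolding deg_def using assms(5) by (intro arg_cong[where f = card]) (auto simp: separators_def)
  ultimately show ?thesis
    by (simp add: deg_singleton irrefl adj_commute[of v w])
qed

text \<open>The single separator in \<open>R\<close> costs exactly one of \<open>v\<close> and
  \<open>w\<close> a neighbour; every other vertex of \<open>R\<close> costs both or
  neither.\<close>

lemma deg_Diff_differ_by_one:
  assumes "finite V" "R \<subseteq> V" "v \<in> V - R" "w \<in> V - R" "deg V v = deg V w"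
    and "card (separators V v w \<inter> R) = 1"
  shows "deg (V - R) v = Suc (deg (V - R) w) \<or> deg (V - R) w = Suc (deg (V - R) v)"
proof -
  obtain x where x: "separators V v w \<inter> R = {x}"
    using assms(6) by (auto simp: card_1_singleton_iff)
  have finR: "finite R"
    using assms finite_subset by blast
  have "(V - R) \<union> R = V"
    using assms by auto
  then have V: "deg V y = deg (V - R) y + deg R y" for y
    using deg_Un[of "V - R" R y] assms finR by auto
  have "(R - {x}) \<union> {x} = R"
    using x by auto
  then have R: "deg R y = deg (R - {x}) y + deg {x} y" for y
    using deg_Un[of "R - {x}" "{x}" y] finR by auto
  have "{u \<in> R - {x}. adj v u} = {u \<in> R - {x}. adj w u}"
  proof -
    have "adj v u = adj w u" if "u \<in> R - {x}" for u
      using x that assms(2-4) by (auto simp: separators_def)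
    then show ?thesis by auto
  qed
  then have "deg (R - {x}) v = deg (R - {x}) w"
    by (simp add: deg_def)
  moreover have "adj v x \<noteq> adj w x"
    using x by (auto simp: separators_def)
  ultimately show ?thesis
    using V[of v] V[of w] R[of v] R[of w] assms(5)
    by (cases "adj v x"; cases "adj w x"; simp add: deg_singleton)
qed

section \<open>Disjoint sets of equal size inducing equally many edges\<close>

text \<open>The greedy halving sets the ends of \<open>I\<close> aside. There are enough pairs to
  bring its imbalance of at most \<open>D\<close> down to at most 1.\<close>

lemma exists_equal_bipartition:
  assumes "finite W" "even (card W)" "\<And>v. v \<in> W \<Longrightarrow> deg W v \<le> D"
    and "pairing I" "D \<le> card I" "\<And>p. p \<in> I \<Longrightarrow> ends p \<subseteq> W"
    and "\<And>p. p \<in> I \<Longrightarrow>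
      deg W (fst p) = Suc (deg W (snd p)) \<or> deg W (snd p) = Suc (deg W (fst p))"
  shows "\<exists>A B. A \<union> B = W \<and> A \<inter> B = {} \<and> card A = card B \<and> arc_count A = arc_count B"
proof -
  have "I \<subseteq> W \<times> W"
    using assms(6) by (fastforce simp: ends_def)
  then have finI: "finite I"
    using assms(1) finite_subset by blast
  define Y where "Y = (\<Union>p\<in>I. ends p)"
  have Y: "Y \<subseteq> W" "card Y = 2 * card I"
    using assms(6) card_Union_ends[OF assms(4) finI] by (auto simp: Y_def)
  have "even (card (W - Y))"
    using assms(1,2) Y by (simp add: card_Diff_subset finite_subset)
  then obtain A B where AB: "A \<union> B = W - Y" "A \<inter> B = {}" "card A = card B"
    "\<bar>int (sum (deg W) A) - int (sum (deg W) B)\<bar> \<le> int D"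
    using balanced_partition[of "W - Y" "deg W" D] assms(1,3) by auto
  have "finite A" "finite B"
    using AB(1) assms(1) by (metis finite_Diff finite_Un)+
  moreover have "ends p \<inter> (A \<union> B) = {}" if "p \<in> I" for p
    using that unfolding AB(1) Y_def by auto
  ultimately obtain A' B' where AB': "A' \<union> B' = A \<union> B \<union> (\<Union>p\<in>I. ends p)" "A' \<inter> B' = {}"
    "card A' = card B'"
    "\<bar>int (sum (deg W) A') - int (sum (deg W) B')\<bar> \<le> max 1 (int D - int (card I))"
    using balanced_partition_extend[of I A B "deg W" D] finI assms(4,7) AB by metis
  have U: "A' \<union> B' = W"
    using AB(1) AB'(1) Y by (auto simp: Y_def)
  have fin: "finite A'" "finite B'"
    using U assms(1) by auto
  \<comment> \<open>The two sums add up to an even number, so a difference of at most 1 must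
    vanish.\<close>
  have "sum (deg W) A' + sum (deg W) B' = arc_count W"
    using U AB'(2) fin by (simp add: arc_count_def flip: sum.union_disjoint)
  then have "even (sum (deg W) A' + sum (deg W) B')"
    using even_arc_count[OF assms(1)] by simp
  moreover have "\<bar>int (sum (deg W) A') - int (sum (deg W) B')\<bar> \<le> 1"
    using AB'(4) assms(5) by simp
  then have "sum (deg W) A' \<le> Suc (sum (deg W) B')" "sum (deg W) B' \<le> Suc (sum (deg W) A')"
    by linarith+
  moreover have "a = b" if "even (a + b)" "a \<le> Suc b" "b \<le> Suc a" for a b :: nat
    using that by presburger
  ultimately have "sum (deg W) A' = sum (deg W) B'"
    by blast
  then have "arc_count A' = arc_count B'"
    using arc_count_eqI[of A' B'] U AB'(2) fin by simp
  with U AB' show ?thesis by blast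
qed

text \<open>Pigeonhole over \<open>m\<close> dyadic ranges of separator sizes gives many pairs with
  comparable sizes. Removing a set that hits their separators exactly once produces pairs with
  degrees differing by one.\<close>

lemma exists_equal_pair_of_separated:
  assumes "finite V" and D: "\<And>v. v \<in> V \<Longrightarrow> deg V v \<le> D"
    and I: "I \<subseteq> V \<times> V" "pairing I" "\<And>p. p \<in> I \<Longrightarrow> deg V (fst p) = deg V (snd p)"
      "\<And>p. p \<in> I \<Longrightarrow> separators V (fst p) (snd p) \<noteq> {}"
    and m: "2 * D < 2 ^ m" "0 < m" and large: "11 * (2 * D + 1) * m \<le> card I"
  shows "\<exists>A B. A \<subseteq> V \<and> B \<subseteq> V \<and> A \<inter> B = {} \<and> card A = card B \<and> arc_count A = arc_count B \<and>
    card V \<le> 2 * card A + 2 * D + 2"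
proof -
  define K where "K p = separators V (fst p) (snd p)" for p
  have finI: "finite I"
    using I(1) assms(1) finite_subset by blast
  have KV: "K p \<subseteq> V" for p
    by (auto simp: K_def separators_def)
  have K1: "1 \<le> card (K p)" if "p \<in> I" for p
    using I(4)[OF that] KV[of p] assms(1) finite_subset
    by (metis K_def One_nat_def Suc_leI card_gt_0_iff)
  have K2: "card (K p) \<le> 2 * D" if "p \<in> I" for p
  proof -
    have "K p \<subseteq> {u\<in>V. adj (fst p) u} \<union> {u\<in>V. adj (snd p) u}"
      by (auto simp: K_def separators_def)
    then have "card (K p) \<le> card ({u\<in>V. adj (fst p) u} \<union> {u\<in>V. adj (snd p) u})"
      using assms(1) by (intro card_mono) auto
    also have "\<dots> \<le> deg V (fst p) + deg V (snd p)"
      unfolding deg_def by (rule card_Un_le)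
    also have "\<dots> \<le> D + D"
      using that I(1) by (intro add_mono D) auto
    finally show ?thesis by simp
  qed
  \<comment> \<open>The range is closed at both ends to match the size hypotheses of
    \<open>exists_hitting_once\<close> with \<open>\<kappa> = 2 ^ j\<close>; overlaps are harmless
    for a covering.\<close>
  define L where "L j = {p\<in>I. 2 ^ j \<le> card (K p) \<and> card (K p) \<le> 2 * 2 ^ j}" for j :: nat
  have "\<exists>j<m. p \<in> L j" if p: "p \<in> I" for p
  proof -
    obtain j where j: "2 ^ j \<le> card (K p)" "card (K p) < 2 ^ (j + 1)"
      using ex_power_ivl1[of 2 "card (K p)"] K1[OF p] by auto
    have "(2::nat) ^ j < 2 ^ m"
      using j(1) K2[OF p] m(1) by linarith
    with j p show ?thesis by (auto simp: L_def)
  qed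
  then have "I \<subseteq> (\<Union>j<m. L j)" by auto
  then have "card I \<le> card (\<Union>j<m. L j)"
    using finI by (intro card_mono) (auto simp: L_def)
  also have "\<dots> \<le> (\<Sum>j<m. card (L j))"
    by (rule card_UN_le) simp
  finally have sum: "card I \<le> (\<Sum>j<m. card (L j))" .
  have "\<exists>j<m. 11 * (2 * D + 1) \<le> card (L j)"
  proof (rule ccontr)
    assume "\<not> ?thesis"
    then have "(\<Sum>j<m. card (L j)) < (\<Sum>j<m. 11 * (2 * D + 1))"
      using m(2) by (intro sum_strict_mono) (auto simp: not_le)
    with sum large show False by (simp add: mult.commute)
  qed
  then obtain j where j: "11 * (2 * D + 1) \<le> card (L j)" by auto
  have LI: "L j \<subseteq> I" by (auto simp: L_def)
  \<comment> \<open>Of the \<open>2 * D + 1\<close> pairs, up to \<open>D + 1\<close> may be given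
    up for parity below, and \<open>D\<close> must remain.\<close>
  have "\<exists>R\<subseteq>V. card R \<le> 2 * D + 1 \<and>
    2 * D + 1 \<le> card {p\<in>L j. ends p \<inter> R = {} \<and> card (K p \<inter> R) = 1}"
  proof (rule exists_hitting_once[where \<kappa> = "2 ^ j"])
    show "disjoint_family_on ends (L j)"
      using pairing_subset[OF I(2) LI] by (simp add: pairing_def)
    show "finite (L j)"
      using finI LI finite_subset by blast
    show "card (ends p) \<le> 2" if "p \<in> L j" for p
      by (simp add: ends_def card_insert_if)
  qed (use assms(1) KV I(1) j in \<open>auto simp: L_def ends_def K_def separators_def\<close>)
  then obtain R where R: "R \<subseteq> V" "card R \<le> 2 * D + 1"
    "2 * D + 1 \<le> card {p\<in>L j. ends p \<inter> R = {} \<and> card (K p \<inter> R) = 1}"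
    by blast
  define J where "J = {p\<in>L j. ends p \<inter> R = {} \<and> card (K p \<inter> R) = 1}"
  have JI: "J \<subseteq> I"
    using LI by (auto simp: J_def)
  have pJ: "pairing J"
    using pairing_subset[OF I(2) JI] .
  have finJ: "finite J"
    using finI JI finite_subset by blast
  define X where "X = V - R"
  have finX: "finite X"
    using assms(1) by (simp add: X_def)
  have cardX: "card V = card X + card R"
    using R(1) assms(1) by (metis X_def Diff_partition card_Diff_subset card_mono finite_subset
        le_add_diff_inverse2)
  have JX: "ends p \<subseteq> X" if "p \<in> J" for p
    using that JI I(1) by (auto simp: J_def X_def ends_def)
  have degJ: "deg X (fst p) = Suc (deg X (snd p)) \<or> deg X (snd p) = Suc (deg X (fst p))"
    if p: "p \<in> J" for p
    unfolding X_def using p JX[OF p] R(1) assms(1) I(3)[of p] JI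
    by (intro deg_Diff_differ_by_one) (auto simp: X_def J_def K_def ends_def)
  have "\<exists>W I'. W \<subseteq> X \<and> card X \<le> card W + 1 \<and> even (card W) \<and> I' \<subseteq> J \<and> D \<le> card I' \<and>
    (\<forall>p\<in>I'. ends p \<subseteq> W \<and> (\<forall>v\<in>ends p. deg W v = deg X v))"
  proof (cases "even (card X)")
    case True
    then show ?thesis
      using JX R(3) by (intro exI[of _ X] exI[of _ J]) (auto simp: J_def)
  next
    case False
    then obtain w where w: "w \<in> X" by fastforce
    \<comment> \<open>Removing \<open>w\<close> to make the size even alters only the degrees of its
      neighbours. Pairs avoiding this closed neighbourhood therefore keep their degrees; the others,
      at most \<open>card S\<close> by disjointness, stop serving as correcting pairs.\<close>
    define S where "S = insert w {u\<in>X. adj w u}"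
    have "card S \<le> Suc (deg X w)"
      by (simp add: S_def deg_def card_insert_le_m1)
    also have "deg X w \<le> D"
      using deg_mono[of V X w] assms(1) D[of w] w by (auto simp: X_def)
    finally have cS: "card S \<le> D + 1" by simp
    define I' where "I' = {p\<in>J. ends p \<inter> S = {}}"
    have "card {p\<in>J. ends p \<inter> S \<noteq> {}} \<le> card S"
      using pJ finX by (intro card_disjoint_meeting_le) (auto simp: pairing_def S_def)
    moreover have "card J = card I' + card {p\<in>J. ends p \<inter> S \<noteq> {}}"
    proof -
      have "J = I' \<union> {p\<in>J. ends p \<inter> S \<noteq> {}}" "I' \<inter> {p\<in>J. ends p \<inter> S \<noteq> {}} = {}"
        by (auto simp: I'_def)
      then show ?thesis
        using finJ by (metis card_Un_disjoint finite_Un)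
    qed
    ultimately have "D \<le> card I'"
      using cS R(3) unfolding J_def[symmetric] by linarith
    moreover have "ends p \<subseteq> X - {w} \<and> (\<forall>v\<in>ends p. deg (X - {w}) v = deg X v)"
      if p: "p \<in> I'" for p
    proof -
      have "deg (X - {w}) v = deg X v" if v: "v \<in> ends p" for v
      proof -
        have "\<not> adj v w"
          using p v JX[of p] by (auto simp: I'_def S_def adj_commute[of v w])
        then show ?thesis
          unfolding deg_def by (intro arg_cong[where f = card]) auto
      qed
      then show ?thesis
        using p JX[of p] by (auto simp: I'_def S_def)
    qed
    moreover have "even (card (X - {w}))" "card X \<le> card (X - {w}) + 1"
      using False w finX by auto
    ultimately show ?thesis
      by (intro exI[of _ "X - {w}"] exI[of _ I']) (auto simp: I'_def)
  qed
  then obtain W I' where W: "W \<subseteq> X" "card X \<le> card W + 1" "even (card W)" "I' \<subseteq> J"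
    "D \<le> card I'" and I': "\<And>p. p \<in> I' \<Longrightarrow> ends p \<subseteq> W"
    "\<And>p v. p \<in> I' \<Longrightarrow> v \<in> ends p \<Longrightarrow> deg W v = deg X v"
    by blast
  have finW: "finite W"
    using W(1) finX finite_subset by blast
  have WV: "W \<subseteq> V"
    using W(1) by (auto simp: X_def)
  have "\<exists>A B. A \<union> B = W \<and> A \<inter> B = {} \<and> card A = card B \<and> arc_count A = arc_count B"
  proof (rule exists_equal_bipartition[where D = D and I = I'])
    show "deg W v \<le> D" if "v \<in> W" for v
      using deg_mono[OF assms(1) WV, of v] D[of v] that WV by force
    show "pairing I'"
      using pairing_subset[OF pJ W(4)] .
    show "deg W (fst p) = Suc (deg W (snd p)) \<or> deg W (snd p) = Suc (deg W (fst p))"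
      if p: "p \<in> I'" for p
      using degJ[of p] I'(2)[OF p] p W(4) by (auto simp: ends_def)
  qed (use finW W I' in auto)
  then obtain A B where AB: "A \<union> B = W" "A \<inter> B = {}" "card A = card B"
    "arc_count A = arc_count B" by blast
  have "card W = 2 * card A"
    using AB finW by (metis card_Un_disjoint finite_Un mult_2)
  \<comment> \<open>The loss is \<open>2 * D + 1\<close> for \<open>R\<close> and 1 for
    parity.\<close>
  then have "card V \<le> 2 * card A + 2 * D + 2"
    using cardX R(2) W(2) by linarith
  with AB WV show ?thesis
    by (intro exI[of _ A] exI[of _ B]) auto
qed

text \<open>A maximal matching of vertices with equal \<open>f\<close> consists of twins, and the
  unmatched vertices have distinct values in \<open>{..D}\<close>, so they number at most
  \<open>D + 1\<close>. The function \<open>f\<close> is abstract because it is used with degrees in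
  a set containing \<open>V\<close>.\<close>

lemma exists_equal_pair_of_unseparated:
  assumes "finite V" and D: "\<And>v. v \<in> V \<Longrightarrow> f v \<le> D"
    and twins: "\<And>v w. v \<in> V \<Longrightarrow> w \<in> V \<Longrightarrow> v \<noteq> w \<Longrightarrow> f v = f w \<Longrightarrow> separators V v w = {}"
  shows "\<exists>A B. A \<subseteq> V \<and> B \<subseteq> V \<and> A \<inter> B = {} \<and> card A = card B \<and> arc_count A = arc_count B \<and>
    card V \<le> 2 * card A + D + 1"
proof -
  obtain J where J: "J \<subseteq> V \<times> V" "pairing J" "\<And>p. p \<in> J \<Longrightarrow> f (fst p) = f (snd p)"
    "\<And>v w. v \<in> V - (\<Union>p\<in>J. ends p) \<Longrightarrow> w \<in> V - (\<Union>p\<in>J. ends p) \<Longrightarrow> v \<noteq> w \<Longrightarrow> f v \<noteq> f w"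
    using exists_maximal_pairing[OF assms(1), of "\<lambda>v w. f v = f w"] by metis
  have finJ: "finite J"
    using J(1) assms(1) finite_subset by blast
  define A where "A = fst ` J"
  define B where "B = snd ` J"
  have eqI: "p = q" if "p \<in> J" "q \<in> J" "x \<in> ends p" "x \<in> ends q" for p q x
    using J(2) that unfolding pairing_def disjoint_family_on_def by blast
  have inj: "inj_on fst J" "inj_on snd J"
    by (auto intro!: inj_onI intro: eqI simp: ends_def simp del: prod.collapse)
      (metis eqI ends_def insertI1 insertI2 fst_conv snd_conv)+
  have disj: "A \<inter> B = {}"
  proof (rule ccontr)
    assume "A \<inter> B \<noteq> {}"
    then obtain p q where "p \<in> J" "q \<in> J" "fst p = snd q"
      by (auto simp: A_def B_def)
    moreover from this have "p = q"
      by (intro eqI[of p q "fst p"]) (auto simp: ends_def)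
    ultimately show False
      using J(2) by (auto simp: pairing_def)
  qed
  have U: "(\<Union>p\<in>J. ends p) = A \<union> B"
    by (auto simp: A_def B_def ends_def)
  have AV: "A \<subseteq> V" "B \<subseteq> V"
    using J(1) by (auto simp: A_def B_def)
  have fin: "finite A" "finite B"
    using finJ by (auto simp: A_def B_def)
  have cards: "card A = card J" "card B = card J"
    using inj by (auto simp: A_def B_def card_image)
  \<comment> \<open>Twins in \<open>V\<close> remain twins in the subset
    \<open>A \<union> B\<close>, whatever their degrees in \<open>V\<close> were.\<close>
  have "deg (A \<union> B) (fst p) = deg (A \<union> B) (snd p)" if p: "p \<in> J" for p
  proof (rule deg_eq_if_no_separators)
    show "fst p \<noteq> snd p"
      using J(2) p by (auto simp: pairing_def)
    then have "separators V (fst p) (snd p) = {}"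
      using p J(1,3) by (intro twins) auto
    then show "separators (A \<union> B) (fst p) (snd p) = {}"
      using AV by (auto simp: separators_def)
  qed (use p fin in \<open>auto simp: A_def B_def\<close>)
  then have "(\<Sum>v\<in>A. deg (A \<union> B) v) = (\<Sum>v\<in>B. deg (A \<union> B) v)"
    using inj by (simp add: A_def B_def sum.reindex)
  then have "arc_count A = arc_count B"
    using fin disj by (intro arc_count_eqI)
  moreover have "card V \<le> 2 * card A + D + 1"
  proof -
    have "inj_on f (V - (A \<union> B))"
      using J(4) unfolding U by (intro inj_onI) blast
    moreover have "f ` (V - (A \<union> B)) \<subseteq> {..D}"
      using D by auto
    ultimately have "card (V - (A \<union> B)) \<le> card {..D}"
      using card_inj_on_le by blast
    moreover have "card (V - (A \<union> B)) = card V - (card A + card B)"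
      using fin AV disj by (simp add: card_Diff_subset card_Un_disjoint)
    ultimately show ?thesis
      using cards by simp
  qed
  ultimately show ?thesis
    using AV disj cards by (intro exI[of _ A] exI[of _ B]) auto
qed

text \<open>The error terms account for the deleted vertices of high degree, for both ends of fewer
  than \<open>11 * (2 * D + 1) * m\<close> pairs when the family is small, and for the losses of the
  two cases.\<close>

lemma exists_equal_pair:
  assumes "finite V" and m: "2 * D < 2 ^ m" "0 < m"
  shows "\<exists>A B. A \<subseteq> V \<and> B \<subseteq> V \<and> A \<inter> B = {} \<and> card A = card B \<and> arc_count A = arc_count B \<and>
    card V \<le> 2 * card A + card {v\<in>V. D < deg V v} + 22 * (2 * D + 1) * m + 2 * D + 2"
proof -
  define X where "X = {v\<in>V. deg V v \<le> D}"
  have finX: "finite X"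
    using assms(1) by (simp add: X_def)
  have D: "deg X v \<le> D" if "v \<in> X" for v
    using that deg_mono[of V X v] assms(1) by (force simp: X_def)
  have "V = X \<union> {v\<in>V. D < deg V v}" "X \<inter> {v\<in>V. D < deg V v} = {}"
    by (auto simp: X_def)
  then have cV: "card V = card X + card {v\<in>V. D < deg V v}"
    using assms(1) by (metis card_Un_disjoint finite_Un)
  define Q where "Q v w \<longleftrightarrow> deg X v = deg X w \<and> separators X v w \<noteq> {}" for v w
  obtain I where I: "I \<subseteq> X \<times> X" "pairing I" "\<And>p. p \<in> I \<Longrightarrow> Q (fst p) (snd p)"
    "\<And>v w. v \<in> X - (\<Union>p\<in>I. ends p) \<Longrightarrow> w \<in> X - (\<Union>p\<in>I. ends p) \<Longrightarrow> v \<noteq> w \<Longrightarrow> \<not> Q v w"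
    using exists_maximal_pairing[OF finX, of Q] by metis
  have "\<exists>A B. A \<subseteq> X \<and> B \<subseteq> X \<and> A \<inter> B = {} \<and> card A = card B \<and> arc_count A = arc_count B \<and>
    card X \<le> 2 * card A + 22 * (2 * D + 1) * m + 2 * D + 2"
  proof (cases "11 * (2 * D + 1) * m \<le> card I")
    case True
    have "\<exists>A B. A \<subseteq> X \<and> B \<subseteq> X \<and> A \<inter> B = {} \<and> card A = card B \<and>
      arc_count A = arc_count B \<and> card X \<le> 2 * card A + 2 * D + 2"
      using I(3) by (intro exists_equal_pair_of_separated[OF finX D I(1,2) _ _ m True])
        (auto simp: Q_def)
    then show ?thesis by (meson le_trans add_le_mono1 le_add1)
  next
    case False
    have finI: "finite I"
      using I(1) finX finite_subset by blast
    define Y where "Y = X - (\<Union>p\<in>I. ends p)"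
    have YX: "Y \<subseteq> X" by (auto simp: Y_def)
    have "(\<Union>p\<in>I. ends p) \<subseteq> X"
      using I(1) by (auto simp: ends_def)
    then have cY: "card X = card Y + 2 * card I"
      using card_Union_ends[OF I(2) finI] finX
      by (metis Y_def card_Diff_subset card_mono finite_subset le_add_diff_inverse2)
    \<comment> \<open>Maximality of \<open>I\<close> concerns degrees in \<open>X\<close>, so
      \<open>f\<close> is \<open>deg X\<close> although the sets are sought in \<open>Y\<close>.
      Twins in \<open>X\<close> are twins in \<open>Y\<close>.\<close>
    have "\<exists>A B. A \<subseteq> Y \<and> B \<subseteq> Y \<and> A \<inter> B = {} \<and> card A = card B \<and>
      arc_count A = arc_count B \<and> card Y \<le> 2 * card A + D + 1"
    proof (rule exists_equal_pair_of_unseparated[where f = "deg X"])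
      show "separators Y v w = {}"
        if "v \<in> Y" "w \<in> Y" "v \<noteq> w" "deg X v = deg X w" for v w
        using I(4)[of v w] that YX by (auto simp: Q_def Y_def separators_def)
    qed (use finX D YX in \<open>auto simp: Y_def\<close>)
    then obtain A B where "A \<subseteq> Y" "B \<subseteq> Y" "A \<inter> B = {}" "card A = card B"
      "arc_count A = arc_count B" "card Y \<le> 2 * card A + D + 1" by blast
    moreover from this have "card X \<le> 2 * card A + 22 * (2 * D + 1) * m + 2 * D + 2"
      using False cY by (simp add: algebra_simps)
    ultimately show ?thesis
      using YX by (intro exI[of _ A] exI[of _ B]) auto
  qed
  then obtain A B where "A \<subseteq> X" "B \<subseteq> X" "A \<inter> B = {}" "card A = card B"
    "arc_count A = arc_count B" "card X \<le> 2 * card A + 22 * (2 * D + 1) * m + 2 * D + 2"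
    by blast
  with cV show ?thesis
    by (intro exI[of _ A] exI[of _ B]) (auto simp: X_def)
qed

section \<open>Real-valued bounds for sparse relations\<close>

lemma card_high_degree_le:
  assumes "finite V" "real (arc_count V) \<le> 2 * y\<^sup>2" "0 < y"
  shows "real (card {v\<in>V. nat \<lfloor>y\<rfloor> < deg V v}) \<le> 2 * y"
proof -
  define H where "H = {v\<in>V. nat \<lfloor>y\<rfloor> < deg V v}"
  \<comment> \<open>Markov's inequality: each vertex of \<open>H\<close> contributes at least
    \<open>y\<close> to a degree sum of at most \<open>2 * y\<^sup>2\<close>.\<close>
  have "real (card H) * y = (\<Sum>v\<in>H. y)" by simp
  also have "\<dots> \<le> (\<Sum>v\<in>H. real (deg V v))"
  proof (rule sum_mono)
    fix v assume "v \<in> H"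
    then show "y \<le> real (deg V v)"
      unfolding H_def by (simp, linarith)
  qed
  also have "\<dots> \<le> (\<Sum>v\<in>V. real (deg V v))"
    using assms(1) by (intro sum_mono2) (auto simp: H_def)
  also have "\<dots> \<le> (2 * y) * y"
    using assms(2) by (simp add: arc_count_def power2_eq_square)
  finally show ?thesis
    using assms(3) by (simp add: H_def)
qed

lemma exists_large_equal_pair:
  assumes "finite V" and n: "card V = n" "1 \<le> n" and y: "0 < y" "y \<le> real n"
    and "real (arc_count V) \<le> 2 * y\<^sup>2"
    and bound: "2 * y + 22 * (2 * y + 1) * (log 2 (2 * real n + 1) + 1) + 2 * y + 2
      \<le> 2 * \<epsilon> * real n"
  shows "\<exists>A B. A \<subseteq> V \<and> B \<subseteq> V \<and> A \<inter> B = {} \<and> card A = card B \<and> arc_count A = arc_count B \<and>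
    real n / 2 - \<epsilon> * real n \<le> real (card A)"
proof -
  define D where "D = nat \<lfloor>y\<rfloor>"
  \<comment> \<open>Chosen so that \<open>2 ^ m\<close> is at least \<open>2 * n + 1\<close>, which
    exceeds \<open>2 * D\<close> because \<open>D \<le> y \<le> n\<close>.\<close>
  define m where "m = nat \<lceil>log 2 (2 * real n + 1)\<rceil>"
  have D: "real D \<le> y"
    using y by (simp add: D_def)
  have log_pos: "0 < log 2 (2 * real n + 1)"
    using n by simp
  have m: "log 2 (2 * real n + 1) \<le> real m" "real m \<le> log 2 (2 * real n + 1) + 1"
    using log_pos unfolding m_def by linarith+
  have "2 * real n + 1 = 2 powr log 2 (2 * real n + 1)"
    by simp
  also have "\<dots> \<le> 2 powr real m"
    using m(1) by (intro powr_mono) auto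
  also have "\<dots> = real (2 ^ m)"
    by (simp add: powr_realpow)
  finally have "real (2 * D) < real (2 ^ m)"
    using D y by simp
  then have "2 * D < 2 ^ m" by (simp only: of_nat_less_iff)
  moreover have "0 < m"
    using log_pos m(1) by linarith
  ultimately obtain A B where AB: "A \<subseteq> V" "B \<subseteq> V" "A \<inter> B = {}" "card A = card B"
    "arc_count A = arc_count B"
    "n \<le> 2 * card A + card {v\<in>V. D < deg V v} + 22 * (2 * D + 1) * m + 2 * D + 2"
    using exists_equal_pair[OF assms(1), of D m] n by blast
  have "real n \<le> real (2 * card A + card {v\<in>V. D < deg V v} + 22 * (2 * D + 1) * m + 2 * D + 2)"
    using AB(6) by (simp only: of_nat_le_iff)
  also have "\<dots> = 2 * real (card A) + real (card {v\<in>V. D < deg V v}) +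
      22 * (2 * real D + 1) * real m + 2 * real D + 2"
    by simp
  also have "\<dots> \<le> 2 * real (card A) + 2 * y +
      22 * (2 * y + 1) * (log 2 (2 * real n + 1) + 1) + 2 * y + 2"
    using card_high_degree_le[OF assms(1,6) y(1)] D m y
    by (intro add_mono mult_mono) (auto simp: D_def)
  finally have "real n / 2 - \<epsilon> * real n \<le> real (card A)"
    using bound by linarith
  with AB show ?thesis by blast
qed

end


section \<open>Graphs of diameter two\<close>

text \<open>The dominant term has order \<open>n powr (1 - \<beta>)\<close> times a logarithm, which
  is sublinear.\<close>

lemma error_term_eventually_small:
  fixes \<beta> \<epsilon> :: real
  assumes "0 < \<beta>" "\<beta> < 1" "0 < \<epsilon>"
  shows "\<forall>\<^sub>F n in sequentially. 2 * real n powr (1 - \<beta>) +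
    22 * (2 * real n powr (1 - \<beta>) + 1) * (log 2 (2 * real n + 1) + 1) +
    2 * real n powr (1 - \<beta>) + 2 \<le> 2 * \<epsilon> * real n"
  using assms by real_asymp

context pair_graph
begin

lemma awalk_cost_unit: "awalk_cost (\<lambda>_. 1) p = real (length p)"
  by (induction p) (auto simp: awalk_cost_def)

lemma gdist_adjacent:
  assumes "(u, v) \<in> parcs G"
  shows "gdist G u v = 1"
proof (rule antisym)
  have "awalk u [(u, v)] v"
    using assms by (auto simp: awalk_simps dest: arc_fst_in_verts arc_snd_in_verts)
  from min_cost_le_walk_cost[OF this, of "\<lambda>_. 1"] show "gdist G u v \<le> 1"
    by (simp add: gdist_def awalk_cost_unit one_ereal_def)
  have "u \<noteq> v"
    using assms pair_no_loops[of "(u, v)"] by auto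
  then show "1 \<le> gdist G u v"
    unfolding gdist_def \<mu>_def
    by (intro INF_greatest) (auto simp: awalk_cost_unit one_ereal_def Suc_le_eq)
qed

text \<open>The diameter gives the upper bound; a walk of length 0 or 1 would make the vertices
  equal or adjacent.\<close>

lemma gdist_nonadjacent:
  assumes "(u, v) \<notin> parcs G" "u \<noteq> v" "u \<in> pverts G" "v \<in> pverts G" "diameter G = 2"
  shows "gdist G u v = 2"
proof (rule antisym)
  have "gdist G u v \<le> (SUP w\<in>pverts G. gdist G u w)"
    using assms(4) by (rule SUP_upper)
  also have "\<dots> \<le> diameter G"
    unfolding diameter_def using assms(3) by (rule SUP_upper)
  finally show "gdist G u v \<le> 2"
    using assms(5) by simp
  have "2 \<le> length p" if "awalk u p v" for p
  proof (cases p)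
    case Nil
    then show ?thesis using that assms(2) by (simp add: awalk_simps)
  next
    case (Cons e q)
    then show ?thesis
      using that assms(1) by (cases q; cases e) (auto simp: awalk_simps)
  qed
  then have "2 \<le> ereal (awalk_cost (\<lambda>_. 1) p)" if "awalk u p v" for p
    using that by (simp add: awalk_cost_unit)
  then show "2 \<le> gdist G u v"
    unfolding gdist_def \<mu>_def by (intro INF_greatest) auto
qed

lemma doubleton_in_edges_iff: "{u, v} \<in> edges G \<longleftrightarrow> (u, v) \<in> parcs G"
  unfolding edges_def using pair_sym_arcs
  by (auto simp: doubleton_eq_iff symmetric_def sym_def)

lemma distance_mset_eq:
  assumes "S \<subseteq> pverts G" "diameter G = 2"
  shows "distance_mset G S =
    replicate_mset (card ({e. e \<subseteq> S \<and> card e = 2} \<inter> edges G)) 1 +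
    replicate_mset (card ({e. e \<subseteq> S \<and> card e = 2} - edges G)) 2"
proof -
  define P where "P = {e. e \<subseteq> S \<and> card e = 2}"
  have "finite S"
    by (rule finite_subset[OF assms(1) pair_finite_verts])
  then have finP: "finite P"
    by (auto simp: P_def)
  have dist: "pair_dist G e = (if e \<in> edges G then 1 else 2)" if e: "e \<in> P" for e
  proof -
    obtain u v where uv: "e = {u, v}" "u \<noteq> v"
      using e by (auto simp: P_def card_2_iff)
    then have "u \<in> pverts G" "v \<in> pverts G"
      using e assms(1) by (auto simp: P_def)
    then show ?thesis
      using uv gdist_adjacent[of u v] gdist_nonadjacent[of u v] assms(2)
      by (simp add: pair_dist_insert[OF pair_graph] doubleton_in_edges_iff)
  qed
  have "mset_set P = mset_set (P \<inter> edges G) + mset_set (P - edges G)"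
    using finP by (subst mset_set_Union[symmetric]) (auto simp: Int_Diff_Un)
  moreover have "image_mset (pair_dist G) (mset_set (P \<inter> edges G)) =
      image_mset (\<lambda>_. 1) (mset_set (P \<inter> edges G))"
    using finP dist by (intro image_mset_cong) auto
  moreover have "image_mset (pair_dist G) (mset_set (P - edges G)) =
      image_mset (\<lambda>_. 2) (mset_set (P - edges G))"
    using finP dist by (intro image_mset_cong) auto
  ultimately show ?thesis
    unfolding distance_mset_def P_def[symmetric]
    by (simp add: image_mset_const_eq)
qed

text \<open>Edges and non-edges in a set of fixed size have a fixed total, so agreement of either
  count forces agreement of both.\<close>

lemma homometric_if_edge_counts_eq:
  assumes "diameter G = 2" "A \<subseteq> pverts G" "B \<subseteq> pverts G" "card A = card B"
    and "card ({e. e \<subseteq> A \<and> card e = 2} \<inter> edges G) = card ({e. e \<subseteq> B \<and> card e = 2} \<inter> edges G) \<or>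
      card ({e. e \<subseteq> A \<and> card e = 2} - edges G) = card ({e. e \<subseteq> B \<and> card e = 2} - edges G)"
  shows "homometric G A B"
proof -
  have fin: "finite A" "finite B"
    using assms(2,3) by (auto intro: finite_subset[OF _ pair_finite_verts])
  have split: "card ({e. e \<subseteq> S \<and> card e = 2} \<inter> edges G) +
      card ({e. e \<subseteq> S \<and> card e = 2} - edges G) = card S choose 2" if "finite S" for S
    using that n_subsets[of S 2]
    by (subst card_Un_disjoint[symmetric]) (auto simp: Int_Diff_Un)
  have "a = b \<and> c = d" if "a + c = k" "b + d = k" "a = b \<or> c = d" for a b c d k :: nat
    using that by auto
  from this[OF split[OF fin(1)] split[OF fin(2), folded assms(4)] assms(5)] show ?thesis
    unfolding homometric_def distance_mset_eq[OF assms(2,1)] distance_mset_eq[OF assms(3,1)] by simp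
qed

section \<open>Counting edges in the graph and in its complement\<close>

sublocale present: graph_relation "\<lambda>u v. (u, v) \<in> parcs G"
  using pair_sym_arcs
  by unfold_locales (auto simp: symmetric_def sym_def dest: pair_no_loops)

sublocale absent: graph_relation "\<lambda>u v. u \<noteq> v \<and> (u, v) \<notin> parcs G"
  by unfold_locales (use present.sym in auto)

lemma present_arc_count:
  assumes "S \<subseteq> pverts G"
  shows "present.arc_count S = 2 * card ({e. e \<subseteq> S \<and> card e = 2} \<inter> edges G)"
proof -
  have "finite S"
    by (rule finite_subset[OF assms pair_finite_verts])
  moreover have "{{u, v} |u v. u \<in> S \<and> v \<in> S \<and> (u, v) \<in> parcs G} =
      {e. e \<subseteq> S \<and> card e = 2} \<inter> edges G"
    (is "?L = ?R")
  proof
    show "?L \<subseteq> ?R"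
    proof
      fix e assume "e \<in> ?L"
      then obtain u v where e: "e = {u, v}" "u \<in> S" "v \<in> S" and uv: "(u, v) \<in> parcs G"
        by blast
      from uv have "u \<noteq> v"
        using present.irrefl by blast
      with e uv show "e \<in> ?R"
        by (simp add: doubleton_in_edges_iff)
    qed
    show "?R \<subseteq> ?L"
    proof
      fix e assume e: "e \<in> ?R"
      then obtain u v where uv: "e = {u, v}" "u \<noteq> v"
        by (auto simp: card_2_iff)
      with e have "u \<in> S" "v \<in> S" "(u, v) \<in> parcs G"
        by (simp_all add: doubleton_in_edges_iff)
      with uv(1) show "e \<in> ?L" by blast
    qed
  qed
  ultimately show ?thesis
    by (simp add: present.arc_count_eq_card_edges)
qed

lemma absent_arc_count:
  assumes "S \<subseteq> pverts G"
  shows "absent.arc_count S = 2 * card ({e. e \<subseteq> S \<and> card e = 2} - edges G)"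
proof -
  have "finite S"
    by (rule finite_subset[OF assms pair_finite_verts])
  moreover have "{{u, v} |u v. u \<in> S \<and> v \<in> S \<and> u \<noteq> v \<and> (u, v) \<notin> parcs G} =
      {e. e \<subseteq> S \<and> card e = 2} - edges G"
    (is "?L = ?R")
  proof
    show "?L \<subseteq> ?R"
    proof
      fix e assume "e \<in> ?L"
      then obtain u v where e: "e = {u, v}" "u \<in> S" "v \<in> S" and uv: "u \<noteq> v \<and> (u, v) \<notin> parcs G"
        by blast
      from uv have "u \<noteq> v"
        using present.irrefl by blast
      with e uv show "e \<in> ?R"
        by (simp add: doubleton_in_edges_iff)
    qed
    show "?R \<subseteq> ?L"
    proof
      fix e assume e: "e \<in> ?R"
      then obtain u v where uv: "e = {u, v}" "u \<noteq> v"
        by (auto simp: card_2_iff)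
      with e have "u \<in> S" "v \<in> S" "u \<noteq> v \<and> (u, v) \<notin> parcs G"
        by (simp_all add: doubleton_in_edges_iff)
      with uv(1) show "e \<in> ?L" by blast
    qed
  qed
  ultimately show ?thesis
    by (simp add: absent.arc_count_eq_card_edges)
qed

lemma pairs_Int_edges: "{e. e \<subseteq> pverts G \<and> card e = 2} \<inter> edges G = edges G"
proof -
  have "e \<subseteq> pverts G \<and> card e = 2" if "e \<in> edges G" for e
  proof -
    obtain u v where uv: "e = {u, v}" "(u, v) \<in> parcs G"
      using \<open>e \<in> edges G\<close> by (auto simp: edges_def)
    then have "u \<noteq> v"
      using present.irrefl by blast
    with uv show ?thesis
      using in_arcsD1[OF uv(2)] in_arcsD2[OF uv(2)] by simp
  qed
  then show ?thesis by blast
qed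

lemma card_pairs_Diff_edges:
  "card ({e. e \<subseteq> pverts G \<and> card e = 2} - edges G) = (card (pverts G) choose 2) - card (edges G)"
proof -
  have "edges G \<subseteq> {e. e \<subseteq> pverts G \<and> card e = 2}"
    using pairs_Int_edges by auto
  then show ?thesis
    using n_subsets[OF pair_finite_verts, of 2] pair_finite_verts
    by (simp add: card_Diff_subset finite_subset)
qed

lemma homometric_number_ge:
  assumes "diameter G = 2" "A \<subseteq> pverts G" "B \<subseteq> pverts G" "A \<inter> B = {}" "card A = card B"
    and "present.arc_count A = present.arc_count B \<or> absent.arc_count A = absent.arc_count B"
  shows "card A \<le> homometric_number G"
proof -
  have "homometric G A B"
    using assms by (intro homometric_if_edge_counts_eq)
      (auto simp: present_arc_count absent_arc_count)
  then have "card A \<in> homometric_sizes G"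
    using assms unfolding homometric_sizes_def by auto
  then show ?thesis
    unfolding homometric_number_def using finite_homometric_sizes[OF pair_graph] by simp
qed

end

theorem theorem7:
  fixes \<alpha> \<epsilon> :: real
  assumes "\<alpha> > 0" and "\<epsilon> > 0"
  shows "\<exists>N::nat. \<forall>n>N. \<forall>G :: 'a pair_pre_digraph.
           pair_graph G \<longrightarrow> card (pverts G) = n \<longrightarrow> diameter G = 2 \<longrightarrow>
           (real (card (edges G)) \<le> real n powr (2 - \<alpha>) \<or>
            real (card (edges G)) \<ge> real (n choose 2) - real n powr (2 - \<alpha>)) \<longrightarrow>
           real (homometric_number G) \<ge> real n / 2 - \<epsilon> * real n"
proof -
  \<comment> \<open>Halving gives \<open>2 * \<beta> \<le> \<alpha>\<close>, so the square of the
    degree threshold dominates the edge bound; the cap keeps \<open>\<beta>\<close> below 1.\<close>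
  define \<beta> where "\<beta> = min \<alpha> 1 / 2"
  have \<beta>: "0 < \<beta>" "\<beta> < 1" "2 * \<beta> \<le> \<alpha>"
    using assms by (auto simp: \<beta>_def)
  obtain N where N: "\<And>n. N \<le> n \<Longrightarrow> 2 * real n powr (1 - \<beta>) +
    22 * (2 * real n powr (1 - \<beta>) + 1) * (log 2 (2 * real n + 1) + 1) +
    2 * real n powr (1 - \<beta>) + 2 \<le> 2 * \<epsilon> * real n"
    using error_term_eventually_small[OF \<beta>(1,2) assms(2)]
    by (auto simp: eventually_sequentially)
  have "real n / 2 - \<epsilon> * real n \<le> real (homometric_number G)"
    if n: "N < n" and G: "pair_graph G" "card (pverts G) = n" "diameter G = 2"
      and few: "real (card (edges G)) \<le> real n powr (2 - \<alpha>) \<or>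
            real (card (edges G)) \<ge> real (n choose 2) - real n powr (2 - \<alpha>)"
    for n and G :: "'a pair_pre_digraph"
  proof -
    interpret pair_graph G by (rule G(1))
    define y where "y = real n powr (1 - \<beta>)"
    have n1: "1 \<le> n" using n by simp
    have y: "0 < y" "y \<le> real n"
      using n1 \<beta> powr_mono[of "1 - \<beta>" 1 "real n"] by (auto simp: y_def)
    have "real n powr (2 - \<alpha>) \<le> real n powr ((1 - \<beta>) + (1 - \<beta>))"
      using n1 \<beta> by (intro powr_mono) auto
    also have "\<dots> = y\<^sup>2"
      by (simp only: y_def powr_add power2_eq_square)
    finally have y2: "real n powr (2 - \<alpha>) \<le> y\<^sup>2" .
    have bound: "2 * y + 22 * (2 * y + 1) * (log 2 (2 * real n + 1) + 1) + 2 * y + 2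
      \<le> 2 * \<epsilon> * real n"
      using N[of n] n by (simp add: y_def)
    from few show ?thesis
    proof
      assume "real (card (edges G)) \<le> real n powr (2 - \<alpha>)"
      then have "real (present.arc_count (pverts G)) \<le> 2 * y\<^sup>2"
        using y2 by (simp add: present_arc_count pairs_Int_edges)
      from present.exists_large_equal_pair[OF pair_finite_verts G(2) n1 y this bound]
      show ?thesis
        using homometric_number_ge[OF G(3)] by (meson of_nat_mono order_trans)
    next
      assume "real (card (edges G)) \<ge> real (n choose 2) - real n powr (2 - \<alpha>)"
      \<comment> \<open>The complement has at most \<open>y\<^sup>2\<close> edges, so the same
        argument runs on non-adjacency.\<close>
      then have "real (absent.arc_count (pverts G)) \<le> 2 * y\<^sup>2"
        using y2 G(2) by (simp add: absent_arc_count card_pairs_Diff_edges of_nat_diff_if)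
      from absent.exists_large_equal_pair[OF pair_finite_verts G(2) n1 y this bound]
      show ?thesis
        using homometric_number_ge[OF G(3)] by (meson of_nat_mono order_trans)
    qed
  qed
  then show ?thesis by blast
qed

end
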